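(* For every integer $n\geq 2$, \[ \frac{1}{35\cdot n}\leq\Gamma(n)\leq\frac{1}{\sqrt{n}}. \]
   Context: A doubly stochastic matrix is a nonnegative real matrix whose rows and columns each sum to $1$. For an $n\times n$ doubly stochastic matrix $A$, its eigenvalues are listed with multiplicity as $1=\lambda_1,\lambda_2,\dots,\lambda_n$, where $\lambda_1=1$ is the trivial eigenvalue (eigenvector the all-ones vector) and the remaining $n-1$ are the nontrivial eigenvalues, ordered so that $1\geq\mathrm{Re}\,\lambda_2\geq\cdots\geq\mathrm{Re}\,\lambda_n\geq -1$; thus $\lambda_2(A)$ is a nontrivial eigenvalue of maximal real part. The edge expansion of $A$ is $\phi(A)=\min_{S\subseteq[n],\,S\neq\emptyset,\,|S|\leq n/2}\frac{1}{|S|}\sum_{i\in S,j\notin S}A_{i,j}$. Define \[ \Gamma(n)=\min\left\{\frac{\phi(A)}{1-\mathrm{Re}\,\lambda_2(A)} : A \text{ is an } n\times n \text{ doubly stochastic matrix}\right\}. \]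
   Formalization: In the definition of Γ(n), matrices with Re λ₂(A)=1 (e.g. the identity), for which the ratio is 0/0, are left out, and the minimum is taken as an infimum (equal to the minimum whenever it is attained). *)

theory Defs
  imports
    Complex_Main
    "HOL-Computational_Algebra.Polynomial"
    "Jordan_Normal_Form.Char_Poly"
begin

definition doubly_stochastic :: "nat \<Rightarrow> real mat \<Rightarrow> bool" where
  "doubly_stochastic n A \<longleftrightarrow>
     A \<in> carrier_mat n n \<and>
     (\<forall>i<n. \<forall>j<n. 0 \<le> A $$ (i, j)) \<and>
     (\<forall>i<n. (\<Sum>j<n. A $$ (i, j)) = 1) \<and>
     (\<forall>j<n. (\<Sum>i<n. A $$ (i, j)) = 1)"

text \<open>Complex eigenvalues, counted with algebraic multiplicity.\<close>

definition eigvals_mset :: "real mat \<Rightarrow> complex multiset" where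
  "eigvals_mset A = proots (char_poly (map_mat complex_of_real A))"

text \<open>One copy of the trivial eigenvalue 1 is removed; if 1 has multiplicity at least two,
  it remains among the nontrivial eigenvalues.\<close>

definition nontrivial_eigvals :: "real mat \<Rightarrow> complex multiset" where
  "nontrivial_eigvals A = eigvals_mset A - {#1#}"

text \<open>A nontrivial eigenvalue of maximal real part. The choice among several such eigenvalues
  is immaterial, as only the real part is used.\<close>

definition lambda2 :: "real mat \<Rightarrow> complex" where
  "lambda2 A = arg_max Re (\<lambda>z. z \<in># nontrivial_eigvals A)"

definition edge_expansion :: "nat \<Rightarrow> real mat \<Rightarrow> real" where
  "edge_expansion n A =
     Min ((\<lambda>S. (\<Sum>i\<in>S. \<Sum>j\<in>{..<n} - S. A $$ (i, j)) / real (card S)) `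
          {S. S \<subseteq> {..<n} \<and> S \<noteq> {} \<and> real (card S) \<le> real n / 2})"

text \<open>The quotient is undefined (of the form 0/0) exactly when the real part of the second
  eigenvalue is 1. Such matrices are left out, since with the convention \<open>x / 0 = 0\<close> they would
  contribute a spurious value 0. The minimum is written as an infimum, which coincides with it
  whenever it is attained.\<close>

definition Gamma_ratio :: "nat \<Rightarrow> real" where
  "Gamma_ratio n =
     Inf {edge_expansion n A / (1 - Re (lambda2 A)) | A.
            doubly_stochastic n A \<and> Re (lambda2 A) \<noteq> 1}"

end

theory Submission
  imports Defs "Jordan_Normal_Form.Schur_Decomposition"
begin

text \<open>
  Lower bound. For \<open>0 \<le> \<alpha> < 1\<close> let \<open>G = (1 - \<alpha>A)\<inverse>\<close>. Its trace is \<open>\<Sum> 1 / (1 - \<alpha>\<lambda>\<^sub>i)\<close>, hence at most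
  \<open>1 / (1 - \<alpha>) + (n - 1) / (1 - \<alpha> Re \<lambda>\<^sub>2)\<close>. By the maximum principle every column of \<open>G\<close> is maximal
  on the diagonal, so the trace over a set \<open>S\<close> is at least the average over \<open>i \<in> S\<close> of
  \<open>\<Sum>k\<in>S. G i k\<close>, the expected discounted time spent in \<open>S\<close> by the chain started in \<open>S\<close>.
  If little mass crosses the cut \<open>(S, T)\<close>, this is close to \<open>1 / (1 - \<alpha>)\<close> for \<open>S\<close> and also for the
  complement \<open>T\<close>, so that the trace is close to \<open>2 / (1 - \<alpha>)\<close>. Taking \<open>1 - \<alpha>\<close> a small multiple of
  \<open>(1 - Re \<lambda>\<^sub>2) / n\<close>, the two estimates are compatible only if \<open>1 - Re \<lambda>\<^sub>2 \<le> 35 n \<phi>\<close>.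

  Upper bound. With \<open>m = \<surd>n\<close> there is an explicit doubly stochastic matrix (Mehta and Schulman's
  Rootn matrix) all of whose nontrivial eigenvalues vanish, while the singleton cut at the first
  index has weight \<open>(m + 1) / (m (m + 2)) \<le> 1 / m\<close>.
\<close>

section \<open>Traces of complex matrices and their resolvents\<close>

lemma sum_diag_mult_commute:
  fixes A B :: "'a :: comm_semiring_0 mat"
  assumes "A \<in> carrier_mat n n" "B \<in> carrier_mat n n"
  shows "(\<Sum>i<n. (A * B) $$ (i, i)) = (\<Sum>i<n. (B * A) $$ (i, i))"
proof -
  have "(\<Sum>i<n. (A * B) $$ (i, i)) = (\<Sum>i<n. \<Sum>k<n. A $$ (i, k) * B $$ (k, i))"
    using assms by (intro sum.cong) (auto simp: scalar_prod_def atLeast0LessThan)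
  also have "\<dots> = (\<Sum>k<n. \<Sum>i<n. B $$ (k, i) * A $$ (i, k))"
    by (subst sum.swap) (simp add: mult.commute)
  also have "\<dots> = (\<Sum>i<n. (B * A) $$ (i, i))"
    using assms by (intro sum.cong) (auto simp: scalar_prod_def atLeast0LessThan)
  finally show ?thesis .
qed

text \<open>Schur triangularization: similarity keeps the characteristic polynomial, and for a
  triangular matrix its roots with multiplicity are the diagonal entries. Sums over eigenvalues
  thereby become sums over a diagonal.\<close>

lemma complex_mat_triangularize:
  fixes A :: "complex mat"
  assumes A: "A \<in> carrier_mat n n"
  obtains B P Q where "similar_mat_wit A B P Q" "upper_triangular B" "B \<in> carrier_mat n n"
    "proots (char_poly A) = mset (diag_mat B)"
proof -
  obtain es where es: "char_poly A = (\<Prod>a\<leftarrow>es. [:- a, 1:])"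
    using char_poly_factorized[OF A] by blast
  define B where "B = schur_upper_triangular A es"
  note B = schur_upper_triangular[OF A es, folded B_def]
  from B(3) obtain P Q where PQ: "similar_mat_wit A B P Q" unfolding similar_mat_def by blast
  have "char_poly A = char_poly B" by (rule char_poly_similar[OF B(3)])
  also have "\<dots> = (\<Prod>a\<leftarrow>diag_mat B. [:- a, 1:])" by (rule char_poly_upper_triangular[OF B(1,2)])
  also have "proots \<dots> = mset (diag_mat B)"
  proof -
    have "proots (\<Prod>a\<leftarrow>xs. [:- a, 1:]) = mset xs" for xs :: "complex list"
    proof (induction xs)
      case (Cons x xs)
      have "(\<Prod>a\<leftarrow>xs. [:- a, 1:]) \<noteq> 0" by (auto simp: prod_list_zero_iff)
      then have "proots ([:- x, 1:] * (\<Prod>a\<leftarrow>xs. [:- a, 1:]))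
          = proots [:- x, 1:] + proots (\<Prod>a\<leftarrow>xs. [:- a, 1:])"
        by (intro proots_mult) auto
      with Cons.IH show ?case by simp
    qed simp
    then show ?thesis .
  qed
  finally show ?thesis using that[OF PQ B(2,1)] by blast
qed

lemma sum_mset_diag_mat:
  assumes "B \<in> carrier_mat n n"
  shows "(\<Sum>x\<in>#mset (diag_mat B). f x) = (\<Sum>i<n. f (B $$ (i, i)))"
  using assms
  by (simp add: diag_mat_def sum_unfold_sum_mset image_mset.compositionality comp_def
      atLeast0LessThan)

text \<open>Cyclicity of the trace brings \<open>Q\<close> next to \<open>P\<close>, where they
  cancel.\<close>

lemma sum_diag_similar:
  fixes A :: "'a :: comm_ring_1 mat"
  assumes A: "A \<in> carrier_mat n n" and sim: "similar_mat_wit A B P Q"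
  shows "(\<Sum>i<n. A $$ (i, i)) = (\<Sum>i<n. B $$ (i, i))"
proof -
  note D = similar_mat_witD2[OF A sim]
  have "(\<Sum>i<n. A $$ (i, i)) = (\<Sum>i<n. (P * B * Q) $$ (i, i))" using D by simp
  also have "\<dots> = (\<Sum>i<n. (Q * (P * B)) $$ (i, i))"
    by (rule sum_diag_mult_commute) (use D in auto)
  also have "Q * (P * B) = B"
    using D by (simp flip: assoc_mult_mat[of Q n n P n B n])
  finally show ?thesis .
qed

lemma sum_proots_char_poly:
  fixes A :: "complex mat"
  assumes A: "A \<in> carrier_mat n n"
  shows "(\<Sum>x\<in>#proots (char_poly A). x) = (\<Sum>i<n. A $$ (i, i))"
proof -
  obtain B P Q where *: "similar_mat_wit A B P Q" "upper_triangular B" "B \<in> carrier_mat n n"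
    "proots (char_poly A) = mset (diag_mat B)"
    by (rule complex_mat_triangularize[OF A])
  show ?thesis
    unfolding *(4) sum_mset_diag_mat[OF *(3)] sum_diag_similar[OF A *(1)] ..
qed

text \<open>Invertibility makes the diagonal of \<open>D\<close> nonzero. Reading row
  \<open>i\<close> of \<open>C * D = 1\<close> from the left forces the entries of \<open>C\<close>
  before the diagonal to vanish one after another; in column \<open>i\<close> only the diagonal term
  is then left.\<close>

lemma upper_triangular_left_inverse_diag:
  fixes C D :: "'a :: field mat"
  assumes C: "C \<in> carrier_mat n n" and D: "D \<in> carrier_mat n n"
    and ut: "upper_triangular D" and CD: "C * D = 1\<^sub>m n" and i: "i < n"
  shows "C $$ (i, i) = inverse (D $$ (i, i))"
proof -
  have nz: "D $$ (j, j) \<noteq> 0" if "j < n" for j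
  proof -
    have "det D \<noteq> 0" using det_mult[OF C D] CD by auto
    then have "0 \<notin> set (diag_mat D)"
      using det_upper_triangular[OF ut D] by (metis prod_list_zero_iff)
    then show ?thesis using that D by (auto simp: diag_mat_def image_iff)
  qed
  have prod: "(\<Sum>k<n. C $$ (i, k) * D $$ (k, j)) = (if i = j then 1 else 0)" if "j < n" for j
  proof -
    have "(C * D) $$ (i, j) = (\<Sum>k<n. C $$ (i, k) * D $$ (k, j))"
      using C D that i by (simp add: scalar_prod_def atLeast0LessThan)
    then show ?thesis using CD that i by simp
  qed
  have low: "C $$ (i, j) = 0" if "j < i" for j
    using that
  proof (induction j rule: less_induct)
    case (less j)
    have "(\<Sum>k<n. C $$ (i, k) * D $$ (k, j)) = (\<Sum>k\<in>{j}. C $$ (i, k) * D $$ (k, j))"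
    proof (rule sum.mono_neutral_right)
      show "\<forall>k\<in>{..<n} - {j}. C $$ (i, k) * D $$ (k, j) = 0"
        using less upper_triangularD[OF ut] D by (auto simp: nat_neq_iff)
    qed (use less.prems i in auto)
    then show ?case using prod[of j] nz[of j] less.prems i by auto
  qed
  have "(\<Sum>k<n. C $$ (i, k) * D $$ (k, i)) = (\<Sum>k\<in>{i}. C $$ (i, k) * D $$ (k, i))"
  proof (rule sum.mono_neutral_right)
    show "\<forall>k\<in>{..<n} - {i}. C $$ (i, k) * D $$ (k, i) = 0"
      using low upper_triangularD[OF ut] D by (auto simp: nat_neq_iff)
  qed (use i in auto)
  then show ?thesis using prod[of i] nz[of i] i by (auto simp: field_simps)
qed

text \<open>The similarity that triangularizes \<open>A\<close> also takes \<open>1 - c A\<close> to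
  the triangular matrix \<open>E\<close>, and \<open>G\<close> to \<open>C = Q G P\<close>. Since
  \<open>C\<close> is a left inverse of \<open>E\<close>, its diagonal consists of the reciprocals
  of the diagonal of \<open>E\<close>.\<close>

lemma sum_diag_resolvent:
  fixes A G :: "complex mat"
  assumes A: "A \<in> carrier_mat n n" and G: "G \<in> carrier_mat n n"
    and inv: "G * (1\<^sub>m n - c \<cdot>\<^sub>m A) = 1\<^sub>m n"
  shows "(\<Sum>i<n. G $$ (i, i)) = (\<Sum>x\<in>#proots (char_poly A). inverse (1 - c * x))"
proof -
  obtain B P Q where *: "similar_mat_wit A B P Q" "upper_triangular B" "B \<in> carrier_mat n n"
    "proots (char_poly A) = mset (diag_mat B)"
    by (rule complex_mat_triangularize[OF A])
  note D = similar_mat_witD2[OF A *(1)]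
  note PC = D(6) and QC = D(7) and BC = *(3)
  define C where "C = Q * G * P"
  have CC: "C \<in> carrier_mat n n" using PC QC G by (auto simp: C_def)
  define E where "E = 1\<^sub>m n - c \<cdot>\<^sub>m B"
  have EC: "E \<in> carrier_mat n n" using BC by (auto simp: E_def)
  have PE: "P * E * Q = 1\<^sub>m n - c \<cdot>\<^sub>m A"
  proof -
    have "P * E = P - c \<cdot>\<^sub>m (P * B)"
      unfolding E_def using PC BC
      by (simp add: mult_minus_distrib_mat[of P n n _ n] mult_smult_distrib[of P n n])
    then have "P * E * Q = P * Q - (c \<cdot>\<^sub>m (P * B)) * Q"
      using PC BC QC by (simp add: minus_mult_distrib_mat[of _ n n _ _ n])
    also have "\<dots> = 1\<^sub>m n - c \<cdot>\<^sub>m A"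
      using PC BC QC D(1,3) by (simp add: mult_smult_assoc_mat[of _ n n Q n])
    finally show ?thesis .
  qed
  note assoc = assoc_mult_mat[of _ n n _ n _ n] mult_carrier_mat[of _ n n _ n]
  have "C * E = Q * (G * (P * E * Q)) * P"
    unfolding C_def using PC EC QC G D(2) by (simp add: assoc)
  also have "\<dots> = 1\<^sub>m n" using inv PE QC PC D(2) by simp
  finally have CE: "C * E = 1\<^sub>m n" .
  have ut: "upper_triangular E" using *(2) BC by (auto simp: E_def upper_triangular_def)
  have "G = P * C * Q"
  proof -
    have "P * C * Q = (P * Q) * G * (P * Q)"
      unfolding C_def using PC QC G
      by (simp add: assoc)
    then show ?thesis using G D(1) by simp
  qed
  then have "similar_mat_wit G C P Q"
    using PC QC CC G D(1,2) by (intro similar_mat_witI[of _ _ n]) auto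
  then have "(\<Sum>i<n. G $$ (i, i)) = (\<Sum>i<n. C $$ (i, i))" by (rule sum_diag_similar[OF G])
  also have "\<dots> = (\<Sum>i<n. inverse (1 - c * B $$ (i, i)))"
  proof (intro sum.cong refl)
    fix i assume "i \<in> {..<n}"
    then have "C $$ (i, i) = inverse (E $$ (i, i))"
      by (intro upper_triangular_left_inverse_diag[OF CC EC ut CE]) auto
    then show "C $$ (i, i) = inverse (1 - c * B $$ (i, i))"
      using BC \<open>i \<in> {..<n}\<close> by (simp add: E_def)
  qed
  finally show ?thesis by (simp add: *(4) sum_mset_diag_mat[OF BC])
qed

section \<open>Eigenvalues of doubly stochastic matrices\<close>

lemma doubly_stochasticD:
  assumes "doubly_stochastic n A"
  shows "A \<in> carrier_mat n n" "\<And>i j. i < n \<Longrightarrow> j < n \<Longrightarrow> 0 \<le> A $$ (i, j)"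
    "\<And>i. i < n \<Longrightarrow> (\<Sum>j<n. A $$ (i, j)) = 1" "\<And>j. j < n \<Longrightarrow> (\<Sum>i<n. A $$ (i, j)) = 1"
  using assms by (auto simp: doubly_stochastic_def)

lemma mem_eigvals_mset_iff:
  assumes A: "A \<in> carrier_mat n n"
  shows "z \<in># eigvals_mset A \<longleftrightarrow>
    (\<exists>v. (\<exists>i<n. v i \<noteq> 0) \<and> (\<forall>i<n. (\<Sum>j<n. complex_of_real (A $$ (i, j)) * v j) = z * v i))"
    (is "_ \<longleftrightarrow> ?R")
proof -
  let ?A = "map_mat complex_of_real A"
  have A': "?A \<in> carrier_mat n n" using A by simp
  have "char_poly ?A \<noteq> 0" using degree_monic_char_poly[OF A'] by auto
  then have "z \<in># eigvals_mset A \<longleftrightarrow> eigenvalue ?A z"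
    by (simp add: eigvals_mset_def eigenvalue_root_char_poly[OF A'])
  also have "\<dots> \<longleftrightarrow> ?R"
  proof
    assume "eigenvalue ?A z"
    then obtain v where v: "v \<in> carrier_vec n" "v \<noteq> 0\<^sub>v n" "?A *\<^sub>v v = z \<cdot>\<^sub>v v"
      using A by (auto simp: eigenvalue_def eigenvector_def)
    have "\<exists>i<n. v $ i \<noteq> 0" using v(1,2) by (auto simp: vec_eq_iff)
    moreover have "(\<Sum>j<n. complex_of_real (A $$ (i, j)) * v $ j) = z * v $ i" if "i < n" for i
    proof -
      have "(?A *\<^sub>v v) $ i = (z \<cdot>\<^sub>v v) $ i" using v(3) by simp
      then show ?thesis using v(1) A that by (simp add: scalar_prod_def atLeast0LessThan)
    qed
    ultimately show ?R by (intro exI[of _ "\<lambda>i. v $ i"]) auto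
  next
    assume ?R
    then obtain v where v: "\<exists>i<n. v i \<noteq> 0"
      "\<And>i. i < n \<Longrightarrow> (\<Sum>j<n. complex_of_real (A $$ (i, j)) * v j) = z * v i" by blast
    have "vec n v \<noteq> 0\<^sub>v n" using v(1) by (auto simp: vec_eq_iff)
    moreover have "?A *\<^sub>v vec n v = z \<cdot>\<^sub>v vec n v"
      using v(2) A by (intro eq_vecI) (auto simp: scalar_prod_def atLeast0LessThan)
    ultimately show "eigenvalue ?A z"
      using A by (auto simp: eigenvalue_def eigenvector_def intro!: exI[of _ "vec n v"])
  qed
  finally show ?thesis .
qed

lemma size_eigvals_mset:
  assumes A: "A \<in> carrier_mat n n"
  shows "size (eigvals_mset A) = n"
  using degree_monic_char_poly[of "map_mat complex_of_real A" n] A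
  by (simp add: eigvals_mset_def size_proots_complex)

lemma one_in_eigvals_mset:
  assumes "doubly_stochastic n A" and "n > 0"
  shows "1 \<in># eigvals_mset A"
  unfolding mem_eigvals_mset_iff[OF doubly_stochasticD(1)[OF assms(1)]]
proof (intro exI[of _ "\<lambda>_. 1"] conjI allI impI)
  fix i assume "i < n"
  then show "(\<Sum>j<n. complex_of_real (A $$ (i, j)) * 1) = 1 * 1"
    using doubly_stochasticD(3)[OF assms(1)] by (simp flip: of_real_sum)
qed (use assms(2) in auto)

text \<open>At an index \<open>k\<close> where the modulus of \<open>v\<close> is largest,
  \<open>z * v k\<close> is a weighted average of entries of modulus at most
  \<open>M\<close>.\<close>

lemma norm_eigvals_le_1:
  assumes ds: "doubly_stochastic n A" and z: "z \<in># eigvals_mset A"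
  shows "cmod z \<le> 1"
proof -
  note D = doubly_stochasticD[OF ds]
  obtain v where v: "\<exists>i<n. v i \<noteq> 0"
      "\<And>i. i < n \<Longrightarrow> (\<Sum>j<n. complex_of_real (A $$ (i, j)) * v j) = z * v i"
    using z unfolding mem_eigvals_mset_iff[OF D(1)] by blast
  define M where "M = Max ((\<lambda>i. cmod (v i)) ` {..<n})"
  have ne: "{..<n} \<noteq> {}" using v(1) by auto
  have M: "cmod (v i) \<le> M" if "i < n" for i
    unfolding M_def using that by (intro Max_ge) auto
  have "M \<in> (\<lambda>i. cmod (v i)) ` {..<n}" unfolding M_def using ne by (intro Max_in) auto
  then obtain k where k: "k < n" "cmod (v k) = M" by auto
  have "M > 0" using v(1) M by (meson less_le_trans zero_less_norm_iff)
  have "cmod z * M = cmod (\<Sum>j<n. complex_of_real (A $$ (k, j)) * v j)"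
    using v(2)[OF k(1)] k(2) by (simp add: norm_mult)
  also have "\<dots> \<le> (\<Sum>j<n. A $$ (k, j) * M)"
    using D(2) k(1) M by (intro sum_norm_le) (auto simp: norm_mult intro!: mult_mono)
  also have "\<dots> = M" using D(3)[OF k(1)] by (simp flip: sum_distrib_right)
  finally show ?thesis using \<open>M > 0\<close> by simp
qed

text \<open>\<open>arg_max\<close> is a choice and says something only if a maximum exists. It does:
  for \<open>n \<ge> 2\<close> the nontrivial eigenvalues form a finite multiset of size
  \<open>n - 1 > 0\<close>.\<close>

lemma lambda2_maximal:
  assumes ds: "doubly_stochastic n A" and n: "n \<ge> 2"
  shows "lambda2 A \<in># nontrivial_eigvals A"
    and "z \<in># nontrivial_eigvals A \<Longrightarrow> Re z \<le> Re (lambda2 A)"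
proof -
  let ?N = "set_mset (nontrivial_eigvals A)"
  have "size (nontrivial_eigvals A) = n - 1"
    using size_eigvals_mset[OF doubly_stochasticD(1)[OF ds]] one_in_eigvals_mset[OF ds] n
    by (simp add: nontrivial_eigvals_def size_Diff_singleton)
  then have "?N \<noteq> {}" using n by auto
  then have "Max (Re ` ?N) \<in> Re ` ?N" by (intro Max_in) auto
  then obtain x where x: "x \<in> ?N" "Re x = Max (Re ` ?N)" by auto
  then have max: "\<not> Re y > Re x" if "y \<in># nontrivial_eigvals A" for y
    using that Max_ge[of "Re ` ?N" "Re y"] by (metis finite_imageI finite_set_mset imageI leD)
  have "lambda2 A \<in># nontrivial_eigvals A \<and>
      (\<forall>z. z \<in># nontrivial_eigvals A \<longrightarrow> Re z \<le> Re (lambda2 A))"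
    unfolding lambda2_def
    by (rule arg_maxI[where x = x]) (use x(1) max in \<open>auto simp: not_less\<close>)
  then show "lambda2 A \<in># nontrivial_eigvals A"
    and "z \<in># nontrivial_eigvals A \<Longrightarrow> Re z \<le> Re (lambda2 A)" by blast+
qed

lemma abs_Re_lambda2_le_1:
  assumes ds: "doubly_stochastic n A" and n: "n \<ge> 2"
  shows "\<bar>Re (lambda2 A)\<bar> \<le> 1"
proof -
  have "lambda2 A \<in># eigvals_mset A"
    using lambda2_maximal(1)[OF ds n]
    by (auto simp: nontrivial_eigvals_def dest: in_diffD)
  then have "cmod (lambda2 A) \<le> 1" by (rule norm_eigvals_le_1[OF ds])
  then show ?thesis using abs_Re_le_cmod[of "lambda2 A"] by linarith
qed

section \<open>The discounted resolvent\<close>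

lemma sum_stochastic_diff:
  assumes ds: "doubly_stochastic n A" and i: "i < n"
  shows "(\<Sum>j<n. A $$ (i, j) * (c - v j)) = c - (\<Sum>j<n. A $$ (i, j) * v j)"
proof -
  have "(\<Sum>j<n. A $$ (i, j) * (c - v j)) = (\<Sum>j<n. A $$ (i, j)) * c - (\<Sum>j<n. A $$ (i, j) * v j)"
    by (simp only: right_diff_distrib sum_subtractf sum_distrib_right)
  then show ?thesis by (simp add: doubly_stochasticD(3)[OF ds i])
qed

text \<open>At an index where \<open>v\<close> takes its minimum \<open>M\<close>, the row average
  is at least \<open>M\<close>, so a negative \<open>M\<close> would satisfy
  \<open>\<alpha> M \<le> M\<close>, impossible for \<open>\<alpha> < 1\<close>. The disjunction in
  \<open>super\<close> exempts indices where the sign is already known, such as the diagonal one in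
  \<open>resolvent_le_diagonal\<close>.\<close>

lemma discounted_minimum_principle:
  fixes v :: "nat \<Rightarrow> real"
  assumes ds: "doubly_stochastic n A" and \<alpha>: "0 \<le> \<alpha>" "\<alpha> < 1"
    and super: "\<And>i. i < n \<Longrightarrow> 0 \<le> v i \<or> \<alpha> * (\<Sum>j<n. A $$ (i, j) * v j) \<le> v i"
    and i: "i < n"
  shows "0 \<le> v i"
proof -
  note D = doubly_stochasticD[OF ds]
  define M where "M = Min (v ` {..<n})"
  have M: "M \<le> v i" if "i < n" for i
    unfolding M_def using that by (intro Min_le) auto
  have "M \<in> v ` {..<n}" unfolding M_def using i by (intro Min_in) auto
  then obtain k where k: "k < n" "v k = M" by auto
  have "M = (\<Sum>j<n. A $$ (k, j) * M)" using D(3)[OF k(1)] by (simp flip: sum_distrib_right)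
  also have "\<dots> \<le> (\<Sum>j<n. A $$ (k, j) * v j)"
    using D(2) k(1) M by (intro sum_mono mult_left_mono) auto
  finally have "\<alpha> * M \<le> \<alpha> * (\<Sum>j<n. A $$ (k, j) * v j)" using \<alpha> by (intro mult_left_mono)
  then have "0 \<le> M \<or> 0 \<le> (1 - \<alpha>) * M" using super[OF k(1)] k(2) by (auto simp: algebra_simps)
  then have "0 \<le> M" using \<alpha> by (auto simp: zero_le_mult_iff)
  then show ?thesis using M[OF i] by simp
qed

text \<open>A kernel vector satisfies \<open>v = \<alpha> A v\<close>; the minimum principle applied
  to \<open>v\<close> and to \<open>- v\<close> makes it zero, so the determinant does not
  vanish.\<close>

lemma resolvent_exists:
  assumes ds: "doubly_stochastic n A" and \<alpha>: "0 \<le> \<alpha>" "\<alpha> < 1"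
  obtains G where "G \<in> carrier_mat n n" "G * (1\<^sub>m n - \<alpha> \<cdot>\<^sub>m A) = 1\<^sub>m n"
    "(1\<^sub>m n - \<alpha> \<cdot>\<^sub>m A) * G = 1\<^sub>m n"
proof -
  note D = doubly_stochasticD[OF ds]
  let ?M = "1\<^sub>m n - \<alpha> \<cdot>\<^sub>m A"
  have M: "?M \<in> carrier_mat n n" using D(1) by auto
  have "det ?M \<noteq> 0"
  proof
    assume "det ?M = 0"
    then obtain v where v: "v \<in> carrier_vec n" "v \<noteq> 0\<^sub>v n" "?M *\<^sub>v v = 0\<^sub>v n"
      using det_0_iff_vec_prod_zero[OF M] by blast
    have eq: "v $ i = \<alpha> * (\<Sum>j<n. A $$ (i, j) * v $ j)" if "i < n" for i
    proof -
      have "(?M *\<^sub>v v) $ i = 0" using v(3) that by simp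
      moreover have "(?M *\<^sub>v v) $ i = (\<Sum>j<n. ((if i = j then 1 else 0) - \<alpha> * A $$ (i, j)) * v $ j)"
        using v(1) D(1) that by (simp add: scalar_prod_def atLeast0LessThan)
      moreover have "\<dots> = (\<Sum>j<n. (if i = j then v $ j else 0)) - \<alpha> * (\<Sum>j<n. A $$ (i, j) * v $ j)"
        unfolding sum_distrib_left sum_subtractf[symmetric]
        by (intro sum.cong) (auto simp: algebra_simps)
      ultimately show ?thesis using that by simp
    qed
    have eq': "- v $ i = \<alpha> * (\<Sum>j<n. A $$ (i, j) * - v $ j)" if "i < n" for i
      by (subst eq[OF that]) (simp add: sum_negf)
    have "v $ i = 0" if "i < n" for i
    proof (rule antisym)
      show "0 \<le> v $ i"
        by (rule discounted_minimum_principle[OF ds \<alpha> _ that, of "\<lambda>i. v $ i"])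
          (intro disjI2 eq_refl eq[symmetric])
      have "0 \<le> - v $ i"
        by (rule discounted_minimum_principle[OF ds \<alpha> _ that, of "\<lambda>i. - v $ i"])
          (intro disjI2 eq_refl eq'[symmetric])
      then show "v $ i \<le> 0" by simp
    qed
    then show False using v(1,2) by (auto simp: vec_eq_iff)
  qed
  from det_non_zero_imp_unit[OF M this, of "()"]
  obtain G where G: "G \<in> carrier_mat n n" "G * ?M = 1\<^sub>m n"
    by (auto simp: Units_def ring_mat_def)
  from mat_mult_left_right_inverse[OF G(1) M G(2)] show ?thesis using that G by blast
qed

section \<open>Entrywise and trace estimates for the resolvent\<close>

context
  fixes n :: nat and A G :: "real mat" and \<alpha> :: real
  assumes ds: "doubly_stochastic n A" and \<alpha>: "0 \<le> \<alpha>" "\<alpha> < 1"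
    and G: "G \<in> carrier_mat n n"
    and inv: "(1\<^sub>m n - \<alpha> \<cdot>\<^sub>m A) * G = 1\<^sub>m n"
begin

lemma resolvent_equation:
  assumes "i < n" "k < n"
  shows "G $$ (i, k) = (if i = k then 1 else 0) + \<alpha> * (\<Sum>j<n. A $$ (i, j) * G $$ (j, k))"
proof -
  have "((1\<^sub>m n - \<alpha> \<cdot>\<^sub>m A) * G) $$ (i, k)
      = (\<Sum>j<n. ((if i = j then 1 else 0) - \<alpha> * A $$ (i, j)) * G $$ (j, k))"
    using G doubly_stochasticD(1)[OF ds] assms by (simp add: scalar_prod_def atLeast0LessThan)
  also have "\<dots> = (\<Sum>j<n. (if i = j then G $$ (j, k) else 0)) - \<alpha> * (\<Sum>j<n. A $$ (i, j) * G $$ (j, k))"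
    unfolding sum_distrib_left sum_subtractf[symmetric]
    by (intro sum.cong) (auto simp: algebra_simps)
  finally show ?thesis using inv assms by simp
qed

lemma resolvent_nonneg:
  assumes "i < n" "k < n"
  shows "0 \<le> G $$ (i, k)"
proof (rule discounted_minimum_principle[OF ds \<alpha> _ assms(1), of "\<lambda>i. G $$ (i, k)"])
  fix i assume "i < n"
  then show "0 \<le> G $$ (i, k) \<or> \<alpha> * (\<Sum>j<n. A $$ (i, j) * G $$ (j, k)) \<le> G $$ (i, k)"
    using resolvent_equation[OF _ assms(2), of i] by auto
qed

text \<open>Minimum principle for the drop below the diagonal value. Off the diagonal the resolvent
  equation leaves the slack \<open>(1 - \<alpha>) * G $$ (k, k)\<close>; at \<open>i = k\<close> the
  drop is 0 and the exempting alternative applies.\<close>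

lemma resolvent_le_diagonal:
  assumes "i < n" "k < n"
  shows "G $$ (i, k) \<le> G $$ (k, k)"
proof -
  have "0 \<le> G $$ (k, k) - G $$ (i, k)"
  proof (rule discounted_minimum_principle[OF ds \<alpha> _ assms(1), of "\<lambda>i. G $$ (k, k) - G $$ (i, k)"])
    fix i assume i: "i < n"
    have "\<alpha> * (\<Sum>j<n. A $$ (i, j) * (G $$ (k, k) - G $$ (j, k)))
        = \<alpha> * G $$ (k, k) - \<alpha> * (\<Sum>j<n. A $$ (i, j) * G $$ (j, k))"
      unfolding sum_stochastic_diff[OF ds i] by (simp only: right_diff_distrib)
    moreover have "0 \<le> (1 - \<alpha>) * G $$ (k, k)"
      using \<alpha> resolvent_nonneg[OF assms(2,2)] by simp
    ultimately show "0 \<le> G $$ (k, k) - G $$ (i, k) \<or>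
        \<alpha> * (\<Sum>j<n. A $$ (i, j) * (G $$ (k, k) - G $$ (j, k))) \<le> G $$ (k, k) - G $$ (i, k)"
      using resolvent_equation[OF i assms(2)] by (cases "i = k") (auto simp: left_diff_distrib)
  qed
  then show ?thesis by simp
qed

text \<open>\<open>y i\<close> is the discounted time spent in \<open>S\<close> from
  \<open>i\<close>. Summing its equation over \<open>S\<close> and keeping only targets in
  \<open>S\<close> returns \<open>Y\<close>, up to the column mass that arrives from outside; as
  \<open>y\<close> is at most \<open>1 / (1 - \<alpha>)\<close>, this loss is at most
  \<open>\<delta> / (1 - \<alpha>)\<close>.\<close>

lemma resolvent_set_sum_ge:
  assumes S: "S \<subseteq> {..<n}"
  shows "real (card S) / (1 - \<alpha>) - (\<Sum>i\<in>{..<n} - S. \<Sum>j\<in>S. A $$ (i, j)) / (1 - \<alpha>)\<^sup>2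
    \<le> (\<Sum>i\<in>S. \<Sum>k\<in>S. G $$ (i, k))"
proof -
  note D = doubly_stochasticD[OF ds]
  have fin: "finite S" using S finite_subset by blast
  define y where "y i = (\<Sum>k\<in>S. G $$ (i, k))" for i
  define \<delta> where "\<delta> = (\<Sum>i\<in>{..<n} - S. \<Sum>j\<in>S. A $$ (i, j))"
  have \<delta>: "0 \<le> \<delta>" unfolding \<delta>_def using S D(2) by (intro sum_nonneg) auto
  have y_eq: "y i = (if i \<in> S then 1 else 0) + \<alpha> * (\<Sum>j<n. A $$ (i, j) * y j)" if "i < n" for i
  proof -
    have "y i = (\<Sum>k\<in>S. (if i = k then 1 else 0) + \<alpha> * (\<Sum>j<n. A $$ (i, j) * G $$ (j, k)))"
      unfolding y_def using S that by (intro sum.cong refl resolvent_equation) auto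
    also have "\<dots> = (\<Sum>k\<in>S. if i = k then 1 else 0)
        + \<alpha> * (\<Sum>k\<in>S. \<Sum>j<n. A $$ (i, j) * G $$ (j, k))"
      by (simp add: sum.distrib sum_distrib_left)
    also have "(\<Sum>k\<in>S. \<Sum>j<n. A $$ (i, j) * G $$ (j, k)) = (\<Sum>j<n. A $$ (i, j) * y j)"
      unfolding y_def sum_distrib_left by (rule sum.swap)
    finally show ?thesis using fin by simp
  qed
  have y0: "0 \<le> y i" if "i < n" for i
    unfolding y_def using S that by (intro sum_nonneg resolvent_nonneg) auto
  \<comment> \<open>The constant \<open>1 / (1 - \<alpha>)\<close> is the total discounted time: it
    solves the same equation with source 1 everywhere, hence dominates \<open>y\<close>.\<close>
  have y1: "y i \<le> 1 / (1 - \<alpha>)" if "i < n" for i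
  proof -
    have "0 \<le> 1 / (1 - \<alpha>) - y i"
    proof (rule discounted_minimum_principle[OF ds \<alpha> _ that, of "\<lambda>i. 1 / (1 - \<alpha>) - y i"])
      fix i assume i: "i < n"
      have "\<alpha> * (1 / (1 - \<alpha>)) = 1 / (1 - \<alpha>) - 1" using \<alpha> by (simp add: field_simps)
      then have "\<alpha> * (\<Sum>j<n. A $$ (i, j) * (1 / (1 - \<alpha>) - y j))
          = 1 / (1 - \<alpha>) - 1 - \<alpha> * (\<Sum>j<n. A $$ (i, j) * y j)"
        unfolding sum_stochastic_diff[OF ds i] by (simp only: right_diff_distrib)
      then show "0 \<le> 1 / (1 - \<alpha>) - y i \<or>
        \<alpha> * (\<Sum>j<n. A $$ (i, j) * (1 / (1 - \<alpha>) - y j)) \<le> 1 / (1 - \<alpha>) - y i"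
        using y_eq[OF i] by auto
    qed
    then show ?thesis by simp
  qed
  define Y where "Y = (\<Sum>i\<in>S. y i)"
  have "Y - \<delta> / (1 - \<alpha>) \<le> (\<Sum>j\<in>S. y j) - (\<Sum>j\<in>S. (\<Sum>i\<in>{..<n} - S. A $$ (i, j)) * y j)"
  proof -
    have "(\<Sum>j\<in>S. (\<Sum>i\<in>{..<n} - S. A $$ (i, j)) * y j)
        \<le> (\<Sum>j\<in>S. (\<Sum>i\<in>{..<n} - S. A $$ (i, j)) * (1 / (1 - \<alpha>)))"
      using S D(2) y1 by (intro sum_mono mult_left_mono sum_nonneg) auto
    also have "\<dots> = \<delta> / (1 - \<alpha>)"
      unfolding \<delta>_def sum_distrib_right[symmetric] by (subst sum.swap) simp
    finally show ?thesis by (simp add: Y_def)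
  qed
  \<comment> \<open>Column sums enter here: the mass reaching \<open>j\<close> from within
    \<open>S\<close> is 1 minus the mass reaching it from outside.\<close>
  also have "\<dots> = (\<Sum>j\<in>S. (\<Sum>i\<in>S. A $$ (i, j)) * y j)"
  proof -
    have "(\<Sum>i\<in>S. A $$ (i, j)) = 1 - (\<Sum>i\<in>{..<n} - S. A $$ (i, j))" if "j \<in> S" for j
      using D(4)[of j] sum.subset_diff[OF S, of "\<lambda>i. A $$ (i, j)"] that S by auto
    then show ?thesis by (simp add: left_diff_distrib sum_subtractf)
  qed
  also have "\<dots> \<le> (\<Sum>j<n. (\<Sum>i\<in>S. A $$ (i, j)) * y j)"
    using S D(2) y0 by (intro sum_mono2 mult_nonneg_nonneg sum_nonneg) auto
  also have "\<dots> = (\<Sum>i\<in>S. \<Sum>j<n. A $$ (i, j) * y j)"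
    unfolding sum_distrib_right by (rule sum.swap)
  finally have "\<alpha> * (Y - \<delta> / (1 - \<alpha>)) \<le> \<alpha> * (\<Sum>i\<in>S. \<Sum>j<n. A $$ (i, j) * y j)"
    using \<alpha> by (intro mult_left_mono)
  moreover have "Y = real (card S) + \<alpha> * (\<Sum>i\<in>S. \<Sum>j<n. A $$ (i, j) * y j)"
  proof -
    have "Y = (\<Sum>i\<in>S. 1 + \<alpha> * (\<Sum>j<n. A $$ (i, j) * y j))"
      unfolding Y_def
    proof (rule sum.cong[OF refl])
      fix i assume "i \<in> S"
      then show "y i = 1 + \<alpha> * (\<Sum>j<n. A $$ (i, j) * y j)" using y_eq[of i] S by auto
    qed
    then show ?thesis by (simp add: sum.distrib sum_distrib_left)
  qed
  ultimately have "real (card S) - \<alpha> * (\<delta> / (1 - \<alpha>)) \<le> (1 - \<alpha>) * Y"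
    by (simp add: algebra_simps)
  moreover have "\<alpha> * (\<delta> / (1 - \<alpha>)) \<le> \<delta> / (1 - \<alpha>)"
    using \<alpha> \<delta> by (intro mult_left_le_one_le) auto
  ultimately have "real (card S) - \<delta> / (1 - \<alpha>) \<le> (1 - \<alpha>) * Y" by linarith
  then have "(real (card S) - \<delta> / (1 - \<alpha>)) / (1 - \<alpha>) \<le> Y"
    using \<alpha> by (simp add: pos_divide_le_eq mult.commute)
  then show ?thesis
    unfolding Y_def y_def \<delta>_def by (simp add: diff_divide_distrib power2_eq_square)
qed

text \<open>Diagonal entries dominate their columns, so each of the \<open>card S\<close> rows of
  the double sum is at most the trace over \<open>S\<close>.\<close>

lemma resolvent_set_trace_ge:
  assumes S: "S \<subseteq> {..<n}" "S \<noteq> {}"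
  shows "1 / (1 - \<alpha>) - (\<Sum>i\<in>{..<n} - S. \<Sum>j\<in>S. A $$ (i, j)) / real (card S) / (1 - \<alpha>)\<^sup>2
    \<le> (\<Sum>k\<in>S. G $$ (k, k))"
proof -
  define \<delta> where "\<delta> = (\<Sum>i\<in>{..<n} - S. \<Sum>j\<in>S. A $$ (i, j))"
  have card: "real (card S) > 0" using S finite_subset[OF S(1)] by (simp add: card_gt_0_iff)
  have "real (card S) / (1 - \<alpha>) - \<delta> / (1 - \<alpha>)\<^sup>2 \<le> (\<Sum>i\<in>S. \<Sum>k\<in>S. G $$ (i, k))"
    unfolding \<delta>_def by (rule resolvent_set_sum_ge[OF S(1)])
  also have "\<dots> \<le> (\<Sum>i\<in>S. \<Sum>k\<in>S. G $$ (k, k))"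
    using S by (intro sum_mono resolvent_le_diagonal) auto
  also have "\<dots> = real (card S) * (\<Sum>k\<in>S. G $$ (k, k))" by simp
  finally have "(real (card S) / (1 - \<alpha>) - \<delta> / (1 - \<alpha>)\<^sup>2) / real (card S) \<le> (\<Sum>k\<in>S. G $$ (k, k))"
    using card by (simp add: pos_divide_le_eq mult.commute)
  then show ?thesis using card by (simp add: diff_divide_distrib \<delta>_def mult.commute)
qed

lemma resolvent_trace_eq:
  "complex_of_real (\<Sum>i<n. G $$ (i, i)) = (\<Sum>z\<in>#eigvals_mset A. inverse (1 - of_real \<alpha> * z))"
proof -
  let ?h = "map_mat complex_of_real"
  note A = doubly_stochasticD(1)[OF ds]
  have M: "1\<^sub>m n - \<alpha> \<cdot>\<^sub>m A \<in> carrier_mat n n" using A by auto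
  have "G * (1\<^sub>m n - \<alpha> \<cdot>\<^sub>m A) = 1\<^sub>m n" by (rule mat_mult_left_right_inverse[OF M G inv])
  then have "?h G * ?h (1\<^sub>m n - \<alpha> \<cdot>\<^sub>m A) = 1\<^sub>m n"
    by (metis of_real_hom.mat_hom_mult[OF G M] of_real_hom.mat_hom_one)
  moreover have "?h (1\<^sub>m n - \<alpha> \<cdot>\<^sub>m A) = 1\<^sub>m n - of_real \<alpha> \<cdot>\<^sub>m ?h A"
    using A by (intro eq_matI) auto
  ultimately have "?h G * (1\<^sub>m n - of_real \<alpha> \<cdot>\<^sub>m ?h A) = 1\<^sub>m n" by simp
  then have "(\<Sum>i<n. ?h G $$ (i, i)) = (\<Sum>z\<in>#eigvals_mset A. inverse (1 - of_real \<alpha> * z))"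
    unfolding eigvals_mset_def using A G by (intro sum_diag_resolvent) auto
  then show ?thesis using G by simp
qed

text \<open>The trivial eigenvalue contributes \<open>1 / (1 - \<alpha>)\<close>. For any other
  \<open>z\<close>, \<open>w = 1 - \<alpha> z\<close> has real part at least
  \<open>1 - \<alpha> * Re (lambda2 A) > 0\<close>, and the real part of \<open>1 / w\<close> is at
  most \<open>1 / cmod w\<close>, hence at most \<open>1 / Re w\<close>.\<close>

lemma resolvent_trace_le:
  assumes n: "n \<ge> 2"
  shows "(\<Sum>i<n. G $$ (i, i)) \<le> 1 / (1 - \<alpha>) + (real n - 1) / (1 - \<alpha> * Re (lambda2 A))"
proof -
  let ?N = "nontrivial_eigvals A"
  let ?b = "1 / (1 - \<alpha> * Re (lambda2 A))"
  have one: "1 \<in># eigvals_mset A" using one_in_eigvals_mset[OF ds] n by simp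
  then have split: "eigvals_mset A = add_mset 1 ?N" by (simp add: nontrivial_eigvals_def)
  have size: "real (size ?N) = real n - 1"
    using size_eigvals_mset[OF doubly_stochasticD(1)[OF ds]] split by auto
  have pos: "1 - \<alpha> * Re z > 0" if "z \<in># ?N" for z
  proof -
    have "Re z \<le> 1"
      using norm_eigvals_le_1[OF ds, of z] complex_Re_le_cmod[of z] that split by auto
    then have "\<alpha> * Re z \<le> \<alpha>" using \<alpha> by (simp add: mult_left_le)
    then show ?thesis using \<alpha> by simp
  qed
  have bound: "Re (inverse (1 - of_real \<alpha> * z)) \<le> ?b" if z: "z \<in># ?N" for z
  proof -
    define w where "w = 1 - of_real \<alpha> * z"
    have w: "Re w > 0" using pos[OF z] by (simp add: w_def)
    have "Re (inverse w) \<le> cmod (inverse w)" by (rule complex_Re_le_cmod)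
    also have "\<dots> = 1 / cmod w" by (simp add: norm_inverse divide_inverse)
    also have "\<dots> \<le> 1 / Re w" using w complex_Re_le_cmod[of w] by (intro frac_le) auto
    also have "\<dots> \<le> ?b"
    proof -
      have "Re z \<le> Re (lambda2 A)" by (rule lambda2_maximal(2)[OF ds n z])
      then have "1 - \<alpha> * Re (lambda2 A) \<le> Re w" using \<alpha> by (simp add: w_def mult_left_mono)
      moreover have "1 - \<alpha> * Re (lambda2 A) > 0"
        by (rule pos[OF lambda2_maximal(1)[OF ds n]])
      ultimately show ?thesis using w by (intro divide_left_mono) auto
    qed
    finally show ?thesis unfolding w_def .
  qed
  have Re_sum: "Re (\<Sum>z\<in>#M. f z) = (\<Sum>z\<in>#M. Re (f z))" for f :: "complex \<Rightarrow> complex" and M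
    by (induction M) auto
  have "(\<Sum>i<n. G $$ (i, i)) = Re (complex_of_real (\<Sum>i<n. G $$ (i, i)))" by simp
  also have "\<dots> = Re (inverse (1 - of_real \<alpha>)) + (\<Sum>z\<in>#?N. Re (inverse (1 - of_real \<alpha> * z)))"
    unfolding resolvent_trace_eq split by (simp add: Re_sum)
  also have "Re (inverse (1 - of_real \<alpha>)) = 1 / (1 - \<alpha>)"
    by (metis Re_complex_of_real inverse_eq_divide of_real_1 of_real_diff of_real_inverse)
  also have "(\<Sum>z\<in>#?N. Re (inverse (1 - of_real \<alpha> * z))) \<le> (\<Sum>z\<in>#?N. ?b)"
    by (intro sum_mset_mono bound)
  also have "(\<Sum>z\<in>#?N. ?b) = (real n - 1) / (1 - \<alpha> * Re (lambda2 A))"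
    by (simp add: size)
  finally show ?thesis by simp
qed

end

section \<open>Spectral gap versus the weight of a cut\<close>

text \<open>The rows and the columns indexed by \<open>S\<close> both carry total mass
  \<open>card S\<close>; removing their common block leaves the outflow and the inflow.\<close>

lemma stochastic_cut_symmetric:
  assumes ds: "doubly_stochastic n A" and S: "S \<subseteq> {..<n}"
  shows "(\<Sum>i\<in>{..<n} - S. \<Sum>j\<in>S. A $$ (i, j)) = (\<Sum>i\<in>S. \<Sum>j\<in>{..<n} - S. A $$ (i, j))"
proof -
  note D = doubly_stochasticD[OF ds]
  have fin: "finite S" using S finite_subset by blast
  have "(\<Sum>i\<in>S. \<Sum>j<n. A $$ (i, j)) = (\<Sum>i\<in>S. 1)"
    using S by (intro sum.cong refl D(3)) auto
  moreover have "(\<Sum>j\<in>S. \<Sum>i<n. A $$ (i, j)) = (\<Sum>i\<in>S. 1)"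
    using S by (intro sum.cong refl D(4)) auto
  moreover have "(\<Sum>i\<in>S. \<Sum>j<n. A $$ (i, j))
      = (\<Sum>i\<in>S. \<Sum>j\<in>{..<n} - S. A $$ (i, j)) + (\<Sum>i\<in>S. \<Sum>j\<in>S. A $$ (i, j))"
    by (simp add: sum.subset_diff[OF S] sum.distrib)
  moreover have "(\<Sum>j\<in>S. \<Sum>i<n. A $$ (i, j))
      = (\<Sum>j\<in>S. \<Sum>i\<in>{..<n} - S. A $$ (i, j)) + (\<Sum>j\<in>S. \<Sum>i\<in>S. A $$ (i, j))"
    by (simp add: sum.subset_diff[OF S] sum.distrib)
  moreover have "(\<Sum>j\<in>S. \<Sum>i\<in>S. A $$ (i, j)) = (\<Sum>i\<in>S. \<Sum>j\<in>S. A $$ (i, j))" by (rule sum.swap)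
  moreover have "(\<Sum>j\<in>S. \<Sum>i\<in>{..<n} - S. A $$ (i, j)) = (\<Sum>i\<in>{..<n} - S. \<Sum>j\<in>S. A $$ (i, j))"
    by (rule sum.swap)
  ultimately show ?thesis by simp
qed

lemma spectral_gap_le_cut:
  assumes ds: "doubly_stochastic n A" and n: "n \<ge> 2"
    and S: "S \<subseteq> {..<n}" "S \<noteq> {}" "real (card S) \<le> real n / 2"
  shows "1 - Re (lambda2 A)
    \<le> 35 * real n * ((\<Sum>i\<in>S. \<Sum>j\<in>{..<n} - S. A $$ (i, j)) / real (card S))"
proof (rule ccontr)
  note D = doubly_stochasticD[OF ds]
  define \<delta> where "\<delta> = (\<Sum>i\<in>S. \<Sum>j\<in>{..<n} - S. A $$ (i, j))"
  define \<phi> where "\<phi> = \<delta> / real (card S)"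
  define \<epsilon> where "\<epsilon> = 1 - Re (lambda2 A)"
  assume "\<not> ?thesis"
  then have big: "35 * real n * \<phi> < \<epsilon>" by (simp add: \<phi>_def \<delta>_def \<epsilon>_def)
  have fin: "finite S" using S(1) finite_subset by blast
  have \<delta>: "0 \<le> \<delta>" unfolding \<delta>_def using S(1) D(2) by (intro sum_nonneg) auto
  have cS: "real (card S) > 0" using fin S(2) by (simp add: card_gt_0_iff)
  then have \<phi>: "0 \<le> \<phi>" using \<delta> by (simp add: \<phi>_def)
  have "\<epsilon> > 0" using big \<phi>
    by (meson le_less_trans mult_nonneg_nonneg of_nat_0_le_iff zero_le_numeral)
  have "\<epsilon> \<le> 2" using abs_Re_lambda2_le_1[OF ds n] by (simp add: \<epsilon>_def)
  \<comment> \<open>\<open>\<eta>\<close> becomes the discount gap \<open>1 - \<alpha>\<close>. The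
    factor 8 serves two ends: \<open>35 \<phi> < 8 \<eta>\<close> gives
    \<open>4 \<phi> \<le> \<eta>\<close>, so the two cut corrections together cost at most half of
    \<open>1 / \<eta>\<close>; and \<open>2 \<eta> (n - 1)\<close> stays below
    \<open>\<epsilon> / 4\<close>.\<close>
  define \<eta> where "\<eta> = \<epsilon> / (8 * real n)"
  have \<eta>: "0 < \<eta>" "\<eta> \<le> 1 / 2" "8 * real n * \<eta> = \<epsilon>"
    using \<open>\<epsilon> > 0\<close> \<open>\<epsilon> \<le> 2\<close> n by (auto simp: \<eta>_def field_simps)
  have "real n * (35 * \<phi>) < real n * (8 * \<eta>)" using big \<eta>(3) by (simp add: mult_ac)
  then have "35 * \<phi> < 8 * \<eta>" using n by (simp only: mult_less_cancel_left_pos of_nat_0_less_iff)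
  then have \<phi>\<eta>: "4 * \<phi> \<le> \<eta>" using \<phi> by linarith
  define \<alpha> where "\<alpha> = 1 - \<eta>"
  have \<alpha>: "0 \<le> \<alpha>" "\<alpha> < 1" "1 - \<alpha> = \<eta>" using \<eta> by (auto simp: \<alpha>_def)
  obtain G where G: "G \<in> carrier_mat n n" "(1\<^sub>m n - \<alpha> \<cdot>\<^sub>m A) * G = 1\<^sub>m n"
    using resolvent_exists[OF ds \<alpha>(1,2)] by metis
  let ?T = "{..<n} - S"
  have cT: "real (card ?T) = real n - real (card S)"
    using card_Diff_subset[OF fin S(1)] card_mono[OF _ S(1)] by (simp add: of_nat_diff)
  have "?T \<noteq> {}"
  proof
    assume "?T = {}"
    then have "real (card ?T) = 0" by (simp only: card.empty of_nat_0)
    then show False using cT S(3) n by linarith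
  qed
  have "1 / \<eta> - \<phi> / \<eta>\<^sup>2 \<le> (\<Sum>k\<in>S. G $$ (k, k))"
    using resolvent_set_trace_ge[OF ds \<alpha>(1,2) G S(1,2)] stochastic_cut_symmetric[OF ds S(1)]
    by (simp add: \<alpha>(3) \<phi>_def \<delta>_def)
  \<comment> \<open>The inflow into the complement is the outflow \<open>\<delta>\<close> of
    \<open>S\<close>. As \<open>S\<close> has at most \<open>n / 2\<close> elements, its complement
    is at least as large, so dividing by its cardinality gives at most
    \<open>\<phi>\<close>.\<close>
  moreover have "1 / \<eta> - \<phi> / \<eta>\<^sup>2 \<le> (\<Sum>k\<in>?T. G $$ (k, k))"
  proof -
    have "{..<n} - ?T = S" using S(1) by auto
    then have "1 / \<eta> - \<delta> / real (card ?T) / \<eta>\<^sup>2 \<le> (\<Sum>k\<in>?T. G $$ (k, k))"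
      using resolvent_set_trace_ge[OF ds \<alpha>(1,2) G _ \<open>?T \<noteq> {}\<close>]
      by (simp add: \<alpha>(3) \<delta>_def)
    moreover have "\<delta> / real (card ?T) \<le> \<phi>"
      unfolding \<phi>_def using \<delta> cS cT S(3) by (intro divide_left_mono) auto
    then have "\<delta> / real (card ?T) / \<eta>\<^sup>2 \<le> \<phi> / \<eta>\<^sup>2" by (intro divide_right_mono) auto
    ultimately show ?thesis by linarith
  qed
  moreover have "(\<Sum>k<n. G $$ (k, k)) = (\<Sum>k\<in>?T. G $$ (k, k)) + (\<Sum>k\<in>S. G $$ (k, k))"
    by (rule sum.subset_diff[OF S(1)]) simp
  moreover have "(\<Sum>k<n. G $$ (k, k)) \<le> 1 / \<eta> + (real n - 1) / (1 - \<alpha> * Re (lambda2 A))"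
    using resolvent_trace_le[OF ds \<alpha>(1,2) G n] by (simp add: \<alpha>(3))
  \<comment> \<open>The lower bounds for \<open>S\<close> and its complement contain
    \<open>1 / \<eta>\<close> twice, the upper bound only once; the surplus must come from the
    \<open>n - 1\<close> nontrivial eigenvalues.\<close>
  ultimately have "1 / \<eta> - 2 * (\<phi> / \<eta>\<^sup>2) \<le> (real n - 1) / (1 - \<alpha> * Re (lambda2 A))"
    by simp
  moreover have "2 * (\<phi> / \<eta>\<^sup>2) \<le> 1 / (2 * \<eta>)"
    using \<phi>\<eta> \<eta>(1) by (simp add: field_simps power2_eq_square)
  moreover have "1 / \<eta> = 1 / (2 * \<eta>) + 1 / (2 * \<eta>)" using \<eta>(1) by (simp add: field_simps)
  ultimately have "1 / (2 * \<eta>) \<le> (real n - 1) / (1 - \<alpha> * Re (lambda2 A))" by linarith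
  also have "1 - \<alpha> * Re (lambda2 A) = \<eta> + (1 - \<eta>) * \<epsilon>"
    by (simp add: \<alpha>_def \<epsilon>_def algebra_simps)
  finally have main: "1 / (2 * \<eta>) \<le> (real n - 1) / (\<eta> + (1 - \<eta>) * \<epsilon>)" .
  \<comment> \<open>The denominator in \<open>main\<close> exceeds \<open>\<epsilon> / 2\<close>
    because \<open>\<eta> \<le> 1 / 2\<close>, whereas \<open>main\<close> itself keeps it below
    \<open>\<epsilon> / 4\<close>.\<close>
  have half: "\<epsilon> / 2 \<le> (1 - \<eta>) * \<epsilon>"
    using mult_right_mono[of "1 / 2" "1 - \<eta>" \<epsilon>] \<eta>(2) \<open>\<epsilon> > 0\<close> by simp
  then have "\<eta> + (1 - \<eta>) * \<epsilon> > 0" using \<eta>(1) \<open>\<epsilon> > 0\<close> by linarith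
  with main have "\<eta> + (1 - \<eta>) * \<epsilon> \<le> (real n - 1) * (2 * \<eta>)"
    using \<eta>(1) by (simp add: divide_simps mult_ac split: if_splits)
  also have "\<dots> = \<epsilon> / 4 - 2 * \<eta>" using \<eta>(3) by (simp add: algebra_simps)
  finally show False using half \<eta>(1) \<open>\<epsilon> > 0\<close> by linarith
qed

section \<open>The Rootn matrix\<close>

text \<open>The middle rows are a multiple of the shift plus a rank-one correction that makes the row and
  column sums equal to 1; the first and last row close up the shift.\<close>

definition rootn_mat :: "nat \<Rightarrow> real mat" where
  "rootn_mat n = (let m = sqrt (real n); D = m * (m + 1) * (m + 2);
       a = (m + 1) * (m\<^sup>2 + m - 1) / D; b = (m + 1)\<^sup>2 / D; c = (m + 2) / D;
       e = 1 / D; f = (2 * m + 3) / D; r = (m + 1) / (m + 2)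
     in mat n n (\<lambda>(i, j).
       if i = 0 then (if j = 0 then a else if j = 1 then b else 0)
       else if i = n - 1 then (if j = 0 then b else if j = 1 then f else c)
       else (if j = 0 then 0 else if j = 1 then c else e + (if j = Suc i then r else 0))))"

section \<open>Entries and line sums of the Rootn matrix\<close>

lemma sum_lessThan_split2:
  fixes f :: "nat \<Rightarrow> 'a :: comm_monoid_add"
  assumes "n \<ge> 2"
  shows "(\<Sum>j<n. f j) = f 0 + (f 1 + (\<Sum>j\<in>{2..<n}. f j))"
proof -
  have "{..<n} = insert 0 (insert 1 {2..<n})" using assms by auto
  then show ?thesis by simp
qed

context
  fixes n :: nat and m D :: real
  assumes n: "n \<ge> 2"
  defines "m \<equiv> sqrt (real n)"
  defines "D \<equiv> m * (m + 1) * (m + 2)"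
begin

lemma sqrt_dim_facts: "m > 1" "m * m = real n" "D > 0"
proof -
  show "m > 1" "m * m = real n" using n by (auto simp: m_def)
  then show "D > 0" by (simp add: D_def)
qed

lemma rootn_mat_carrier: "rootn_mat n \<in> carrier_mat n n"
  by (simp add: rootn_mat_def Let_def)

lemma rootn_mat_first_row:
  "rootn_mat n $$ (0, 0) = (m + 1) * (m\<^sup>2 + m - 1) / D"
  "rootn_mat n $$ (0, 1) = (m + 1)\<^sup>2 / D"
  "2 \<le> j \<Longrightarrow> j < n \<Longrightarrow> rootn_mat n $$ (0, j) = 0"
  using n by (auto simp: rootn_mat_def Let_def m_def D_def)

lemma rootn_mat_middle_row:
  assumes "0 < i" "i < n - 1"
  shows "rootn_mat n $$ (i, 0) = 0"
    "rootn_mat n $$ (i, 1) = (m + 2) / D"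
    "2 \<le> j \<Longrightarrow> j < n \<Longrightarrow>
      rootn_mat n $$ (i, j) = 1 / D + (if j = Suc i then (m + 1) / (m + 2) else 0)"
  using n assms by (auto simp: rootn_mat_def Let_def m_def D_def)

lemma rootn_mat_last_row:
  "rootn_mat n $$ (n - 1, 0) = (m + 1)\<^sup>2 / D"
  "rootn_mat n $$ (n - 1, 1) = (2 * m + 3) / D"
  "2 \<le> j \<Longrightarrow> j < n \<Longrightarrow> rootn_mat n $$ (n - 1, j) = (m + 2) / D"
  using n by (auto simp: rootn_mat_def Let_def m_def D_def)

lemma row_index_cases:
  assumes "i < n"
  obtains "i = 0" | "0 < i" "i < n - 1" | "i = n - 1"
  using assms by linarith

text \<open>The scalars range over \<open>real_field\<close> to cover two uses: row sums, with
  \<open>v\<close> constantly 1 over the reals, and eigenvector equations over the complex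
  numbers.\<close>

lemma rootn_mat_apply:
  fixes v :: "nat \<Rightarrow> 'a :: real_field"
  shows "(\<Sum>j<n. of_real (rootn_mat n $$ (0, j)) * v j)
      = of_real ((m + 1) * (m\<^sup>2 + m - 1) / D) * v 0 + of_real ((m + 1)\<^sup>2 / D) * v 1"
    and "0 < i \<Longrightarrow> i < n - 1 \<Longrightarrow> (\<Sum>j<n. of_real (rootn_mat n $$ (i, j)) * v j)
      = of_real ((m + 2) / D) * v 1 + of_real (1 / D) * (\<Sum>j\<in>{2..<n}. v j)
        + of_real ((m + 1) / (m + 2)) * v (Suc i)"
    and "(\<Sum>j<n. of_real (rootn_mat n $$ (n - 1, j)) * v j)
      = of_real ((m + 1)\<^sup>2 / D) * v 0 + of_real ((2 * m + 3) / D) * v 1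
        + of_real ((m + 2) / D) * (\<Sum>j\<in>{2..<n}. v j)"
proof -
  show "(\<Sum>j<n. of_real (rootn_mat n $$ (0, j)) * v j)
      = of_real ((m + 1) * (m\<^sup>2 + m - 1) / D) * v 0 + of_real ((m + 1)\<^sup>2 / D) * v 1"
    unfolding sum_lessThan_split2[OF n] rootn_mat_first_row(1,2)
    using rootn_mat_first_row(3) by simp
  show "(\<Sum>j<n. of_real (rootn_mat n $$ (n - 1, j)) * v j)
      = of_real ((m + 1)\<^sup>2 / D) * v 0 + of_real ((2 * m + 3) / D) * v 1
        + of_real ((m + 2) / D) * (\<Sum>j\<in>{2..<n}. v j)"
    unfolding sum_lessThan_split2[OF n] rootn_mat_last_row(1,2) sum_distrib_left
    using rootn_mat_last_row(3) by (simp add: add.assoc)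
  assume i: "0 < i" "i < n - 1"
  have "(\<Sum>j\<in>{2..<n}. of_real (rootn_mat n $$ (i, j)) * v j)
      = (\<Sum>j\<in>{2..<n}. of_real (1 / D) * v j
          + (if j = Suc i then of_real ((m + 1) / (m + 2)) * v j else 0))"
    using rootn_mat_middle_row(3)[OF i] by (intro sum.cong) (auto simp: algebra_simps)
  also have "\<dots> = of_real (1 / D) * (\<Sum>j\<in>{2..<n}. v j) + of_real ((m + 1) / (m + 2)) * v (Suc i)"
    unfolding sum.distrib sum_distrib_left using i by (subst sum.delta) auto
  finally show "(\<Sum>j<n. of_real (rootn_mat n $$ (i, j)) * v j)
      = of_real ((m + 2) / D) * v 1 + of_real (1 / D) * (\<Sum>j\<in>{2..<n}. v j)
        + of_real ((m + 1) / (m + 2)) * v (Suc i)"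
    unfolding sum_lessThan_split2[OF n] rootn_mat_middle_row(1,2)[OF i] by simp
qed

lemma rootn_shift_coeff: "(m + 1) / (m + 2) = m * (m + 1)\<^sup>2 / D"
  using sqrt_dim_facts(1) by (simp add: D_def power2_eq_square)

text \<open>In order, these serve the first row and column 0; each middle row and each column from 2
  on; the last row and column 1. Over the denominator \<open>D\<close> and with
  \<open>n = m * m\<close>, each is a polynomial identity in \<open>m\<close>.\<close>

lemma rootn_coeff_sums:
  "(m + 1) * (m\<^sup>2 + m - 1) / D + (m + 1)\<^sup>2 / D = 1"
  "(m + 2) / D + (real n - 2) / D + (m + 1) / (m + 2) = 1"
  "(m + 1)\<^sup>2 / D + (2 * m + 3) / D + (m + 2) / D * (real n - 2) = 1"
  unfolding rootn_shift_coeff times_divide_eq_left add_divide_distrib[symmetric]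
    sqrt_dim_facts(2)[symmetric] divide_eq_1_iff
  using sqrt_dim_facts(3) by (auto simp: D_def algebra_simps power2_eq_square)

lemma rootn_mat_doubly_stochastic: "doubly_stochastic n (rootn_mat n)"
  unfolding doubly_stochastic_def
proof (intro conjI allI impI)
  show "rootn_mat n \<in> carrier_mat n n" by (rule rootn_mat_carrier)
  have j_cases: "j = 0 \<or> j = 1 \<or> 2 \<le> j" for j :: nat by linarith
  have n2: "real (n - 2) = real n - 2" using n by (simp add: of_nat_diff)
  show "0 \<le> rootn_mat n $$ (i, j)" if ij: "i < n" "j < n" for i j
  proof -
    have "m\<^sup>2 + m - 1 \<ge> 0" using sqrt_dim_facts(1) by (smt (verit) zero_le_power2)
    then show ?thesis
      using sqrt_dim_facts(1,3) j_cases[of j] ij(2)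
      by (cases rule: row_index_cases[OF ij(1)])
        (auto simp: rootn_mat_first_row rootn_mat_middle_row rootn_mat_last_row
          simp del: One_nat_def)
  qed
  show "(\<Sum>j<n. rootn_mat n $$ (i, j)) = 1" if i: "i < n" for i
    using i
  proof (cases rule: row_index_cases)
    case 1
    then show ?thesis using rootn_mat_apply(1)[of "\<lambda>_. 1 :: real"] rootn_coeff_sums(1) by simp
  next
    case 2
    then show ?thesis
      using rootn_mat_apply(2)[of i "\<lambda>_. 1 :: real"] rootn_coeff_sums(2) n2 by simp
  next
    case 3
    then show ?thesis
      using rootn_mat_apply(3)[of "\<lambda>_. 1 :: real"] rootn_coeff_sums(3) n2 by simp
  qed
  have split: "(\<Sum>i<n. g i) = g 0 + (\<Sum>i\<in>{1..<n - 1}. g i) + g (n - 1)" for g :: "nat \<Rightarrow> real"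
  proof -
    have "{..<n} = insert 0 (insert (n - 1) {1..<n - 1})" using n by auto
    then show ?thesis using n by simp
  qed
  show "(\<Sum>i<n. rootn_mat n $$ (i, j)) = 1" if j: "j < n" for j
  proof -
    consider "j = 0" | "j = 1" | "2 \<le> j" by linarith
    then show ?thesis
    proof cases
      case 1
      then show ?thesis
        unfolding split using rootn_coeff_sums(1)
        by (simp add: rootn_mat_first_row rootn_mat_middle_row rootn_mat_last_row del: One_nat_def)
    next
      case 2
      have "(\<Sum>i\<in>{1..<n - 1}. rootn_mat n $$ (i, 1)) = (\<Sum>i\<in>{1..<n - 1}. (m + 2) / D)"
        by (intro sum.cong rootn_mat_middle_row) auto
      also have "\<dots> = (m + 2) / D * (real n - 2)" using n by (simp add: of_nat_diff)
      finally show ?thesis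
        unfolding split 2 rootn_mat_first_row rootn_mat_last_row using rootn_coeff_sums(3) by simp
    next
      case 3
      \<comment> \<open>Column \<open>j\<close> receives the shift weight only from row
        \<open>j - 1\<close>, which is a middle row since \<open>2 \<le> j < n\<close>.\<close>
      have "(\<Sum>i\<in>{1..<n - 1}. rootn_mat n $$ (i, j))
          = (\<Sum>i\<in>{1..<n - 1}. 1 / D + (if i = j - 1 then (m + 1) / (m + 2) else 0))"
        using j 3 by (intro sum.cong refl) (subst rootn_mat_middle_row, auto)
      also have "\<dots> = (real n - 2) / D + (m + 1) / (m + 2)"
        unfolding sum.distrib using j 3 n by (subst sum.delta) (auto simp: of_nat_diff)
      finally show ?thesis
        unfolding split rootn_mat_first_row(3)[OF 3 j] rootn_mat_last_row(3)[OF 3 j]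
        using rootn_coeff_sums(2) by simp
    qed
  qed
qed

section \<open>Spectrum of the Rootn matrix\<close>

text \<open>The shift lies above the diagonal and adds nothing. For \<open>n = 2\<close> index 1
  belongs to the last row rather than to a middle one, hence the case split.\<close>

lemma rootn_mat_trace: "(\<Sum>i<n. rootn_mat n $$ (i, i)) = 1"
proof (cases "n = 2")
  case True
  have "1 = n - 1" using True by simp
  then have "(\<Sum>i<n. rootn_mat n $$ (i, i)) = rootn_mat n $$ (0, 0) + rootn_mat n $$ (n - 1, 1)"
    using sum_lessThan_split2[OF n, of "\<lambda>i. rootn_mat n $$ (i, i)"] True by simp
  also have "\<dots> = (m + 1) * (m\<^sup>2 + m - 1) / D + (2 * m + 3) / D"
    by (simp only: rootn_mat_first_row rootn_mat_last_row)
  also have "\<dots> = (m * (m * m) + 2 * (m * m) + 2 * m + 2) / D"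
    by (simp add: add_divide_distrib[symmetric] algebra_simps power2_eq_square)
  also have "\<dots> = (4 * m + 6) / D" using sqrt_dim_facts(2) True by simp
  also have "D = m * (m * m) + 3 * (m * m) + 2 * m" by (simp add: D_def algebra_simps)
  also have "\<dots> = 4 * m + 6" using sqrt_dim_facts(2) True by simp
  finally show ?thesis using sqrt_dim_facts(1) by simp
next
  case False
  then have n3: "n \<ge> 3" using n by simp
  have "{2..<n} = insert (n - 1) {2..<n - 1}" using n3 by auto
  then have "(\<Sum>i<n. rootn_mat n $$ (i, i)) = rootn_mat n $$ (0, 0) + (rootn_mat n $$ (1, 1)
      + (rootn_mat n $$ (n - 1, n - 1) + (\<Sum>i\<in>{2..<n - 1}. rootn_mat n $$ (i, i))))"
    unfolding sum_lessThan_split2[OF n] by simp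
  also have "rootn_mat n $$ (1, 1) = (m + 2) / D" using n3 by (intro rootn_mat_middle_row) auto
  also have "rootn_mat n $$ (n - 1, n - 1) = (m + 2) / D"
    using n3 by (intro rootn_mat_last_row) auto
  also have "(\<Sum>i\<in>{2..<n - 1}. rootn_mat n $$ (i, i)) = (\<Sum>i\<in>{2..<n - 1}. 1 / D)"
    by (intro sum.cong refl) (subst rootn_mat_middle_row, auto)
  also have "\<dots> = (m * m - 3) / D" using n3 sqrt_dim_facts(2) by (simp add: of_nat_diff)
  finally show ?thesis
    unfolding rootn_mat_first_row add_divide_distrib[symmetric]
    using sqrt_dim_facts(3) by (simp add: D_def algebra_simps power2_eq_square)
qed

lemma rootn_mat_eigvals:
  assumes "z \<in># eigvals_mset (rootn_mat n)"
  shows "z = 0 \<or> z = 1"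
proof (rule ccontr)
  assume "\<not> (z = 0 \<or> z = 1)"
  then have z: "z \<noteq> 0" "z \<noteq> 1" by auto
  obtain v where v: "\<exists>i<n. v i \<noteq> 0"
      "\<And>i. i < n \<Longrightarrow> (\<Sum>j<n. complex_of_real (rootn_mat n $$ (i, j)) * v j) = z * v i"
    using assms unfolding mem_eigvals_mset_iff[OF rootn_mat_carrier] by blast
  \<comment> \<open>Adding up all eigenvector equations, the unit column sums show that the total of
    \<open>v\<close> is multiplied by \<open>z\<close> and unchanged at once; \<open>z\<close> is
    not 1.\<close>
  have sum0: "(\<Sum>j<n. v j) = 0"
  proof -
    have "z * (\<Sum>i<n. v i) = (\<Sum>i<n. \<Sum>j<n. complex_of_real (rootn_mat n $$ (i, j)) * v j)"
      unfolding sum_distrib_left using v(2) by (intro sum.cong) auto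
    also have "\<dots> = (\<Sum>j<n. (\<Sum>i<n. complex_of_real (rootn_mat n $$ (i, j))) * v j)"
      unfolding sum_distrib_right by (rule sum.swap)
    also have "\<dots> = (\<Sum>j<n. v j)"
      using doubly_stochasticD(4)[OF rootn_mat_doubly_stochastic]
      by (intro sum.cong) (auto simp flip: of_real_sum)
    finally show ?thesis using z(2) by simp
  qed
  define W where "W = (\<Sum>j\<in>{2..<n}. v j)"
  define M where "M = complex_of_real m"
  define E where "E = complex_of_real D"
  have W: "W = - v 0 - v 1"
    using sum0 unfolding sum_lessThan_split2[OF n] W_def
    by (simp add: algebra_simps eq_neg_iff_add_eq_0)
  have M0: "M \<noteq> 0" "M + 1 \<noteq> 0" "M + 2 \<noteq> 0"
    using sqrt_dim_facts(1) unfolding M_def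
    by (auto simp: complex_eq_iff)
  have E: "E = M * (M + 1) * (M + 2)" by (simp add: E_def M_def D_def)
  have E0: "E \<noteq> 0" using M0 by (simp add: E)
  have first: "E * z * v 0 = (M + 1) * (M\<^sup>2 + M - 1) * v 0 + (M + 1)\<^sup>2 * v 1"
    using v(2)[of 0] n E0 unfolding rootn_mat_apply(1)
    by (simp add: field_simps flip: M_def E_def)
  have mid: "E * z * v i = (M + 2) * v 1 + W + M * (M + 1)\<^sup>2 * v (Suc i)"
    if "0 < i" "i < n - 1" for i
  proof -
    have "z * v i = (M + 2) / E * v 1 + 1 / E * W + (M + 1) / (M + 2) * v (Suc i)"
      using v(2)[of i] that unfolding rootn_mat_apply(2)[OF that]
      by (simp add: W_def flip: M_def E_def)
    then have "E * (z * v i) = E * ((M + 2) / E * v 1 + 1 / E * W + (M + 1) / (M + 2) * v (Suc i))"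
      by simp
    also have "\<dots> = (M + 2) * v 1 + W + (E / (M + 2)) * (M + 1) * v (Suc i)"
      using E0 by (simp add: distrib_left[of E] mult.assoc)
    also have "E / (M + 2) = M * (M + 1)" using M0 by (simp add: E)
    finally show ?thesis by (simp add: power2_eq_square mult_ac)
  qed
  have last: "E * z * v (n - 1) = (M + 1)\<^sup>2 * v 0 + (2 * M + 3) * v 1 + (M + 2) * W"
  proof -
    have "z * v (n - 1) = (M + 1)\<^sup>2 / E * v 0 + (2 * M + 3) / E * v 1 + (M + 2) / E * W"
      using v(2)[of "n - 1"] n unfolding rootn_mat_apply(3) W_def[symmetric]
      by (simp flip: M_def E_def)
    then show ?thesis using E0 by (simp add: distrib_left[of E] mult.assoc)
  qed
  \<comment> \<open>Once the tail sum \<open>W\<close> is replaced by \<open>- v 0 - v 1\<close>,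
    the first row equation is \<open>M + 1\<close> times the last one.\<close>
  have "(M + 1) * (E * z * v (n - 1)) = E * z * v 0"
    unfolding first last W by (simp add: algebra_simps power2_eq_square)
  then have "E * z * ((M + 1) * v (n - 1) - v 0) = 0" by (simp add: algebra_simps)
  then have v_last: "(M + 1) * v (n - 1) = v 0" using E0 z(1) by simp
  \<comment> \<open>Along the middle rows the deviation of \<open>v\<close> from \<open>v 0 / (M + 1)\<close> grows geometrically, while the
    first and last rows together force it to end at zero; so it vanishes throughout, and then
    \<open>v\<close> cannot sum to zero.\<close>
  define u where "u i = (M + 1) * v i - v 0" for i
  define \<mu> where "\<mu> = z * (M + 2) / (M + 1)"
  have rec: "u (Suc i) = \<mu> * u i" if "0 < i" "i < n - 1" for i
  proof -
    \<comment> \<open>After inserting \<open>mid\<close> and \<open>W\<close>, all terms other than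
      the one in \<open>v i\<close> combine to minus the right side of \<open>first\<close>, that is
      \<open>- E * z * v 0\<close>. This makes the recursion for \<open>u\<close>
      homogeneous.\<close>
    have "M * (M + 1)\<^sup>2 * u (Suc i) = (M + 1) * (M * (M + 1)\<^sup>2 * v (Suc i)) - M * (M + 1)\<^sup>2 * v 0"
      by (simp add: u_def algebra_simps)
    also have "M * (M + 1)\<^sup>2 * v (Suc i) = E * z * v i - (M + 2) * v 1 - W"
      using mid[OF that] by (simp add: algebra_simps)
    also have "(M + 1) * (E * z * v i - (M + 2) * v 1 - W) - M * (M + 1)\<^sup>2 * v 0
        = (M + 1) * (E * z * v i) - ((M + 1) * (M\<^sup>2 + M - 1) * v 0 + (M + 1)\<^sup>2 * v 1)"
      unfolding W by (simp add: algebra_simps power2_eq_square)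
    also have "\<dots> = E * z * u i" unfolding first[symmetric] u_def by (simp add: algebra_simps)
    also have "E * z = M * (M + 1)\<^sup>2 * \<mu>"
      using M0 by (simp add: E \<mu>_def power2_eq_square)
    finally show ?thesis using M0 by simp
  qed
  have "u i = \<mu> ^ (i - 1) * u 1" if "1 \<le> i" "i < n" for i
    using that
  proof (induction i rule: dec_induct)
    case (step i)
    then show ?case using rec[of i] by (cases i) auto
  qed simp
  note u_pow = this
  have "u (n - 1) = 0" using v_last by (simp add: u_def)
  moreover have "\<mu> \<noteq> 0" using z(1) M0 by (simp add: \<mu>_def)
  ultimately have "u 1 = 0" using u_pow[of "n - 1"] n by auto
  then have v_const: "(M + 1) * v i = v 0" if "1 \<le> i" "i < n" for i
    using u_pow[OF that] by (simp add: u_def)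
  have "0 = (M + 1) * (\<Sum>j<n. v j)" using sum0 by simp
  also have "\<dots> = (M + 1) * v 0 + (v 0 + (\<Sum>j\<in>{2..<n}. v 0))"
    unfolding sum_lessThan_split2[OF n] distrib_left sum_distrib_left using v_const n by simp
  also have "\<dots> = (M + of_nat n) * v 0"
    using n by (simp add: of_nat_diff algebra_simps)
  finally have "(M + of_nat n) * v 0 = 0" by simp
  moreover have "M + of_nat n \<noteq> 0" using sqrt_dim_facts(1) by (auto simp: M_def complex_eq_iff)
  ultimately have "v 0 = 0" by simp
  then have "v i = 0" if "i < n" for i
    using v_const[of i] M0 that by (cases "i = 0") auto
  then show False using v(1) by blast
qed

text \<open>All eigenvalues are 0 or 1 and they sum to the trace 1. The trivial one uses up the
  whole sum, so every other one is 0.\<close>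

lemma rootn_mat_lambda2: "lambda2 (rootn_mat n) = 0"
proof -
  let ?N = "nontrivial_eigvals (rootn_mat n)"
  note ds = rootn_mat_doubly_stochastic
  have split: "eigvals_mset (rootn_mat n) = add_mset 1 ?N"
    using one_in_eigvals_mset[OF ds] n by (simp add: nontrivial_eigvals_def)
  have "(\<Sum>x\<in>#eigvals_mset (rootn_mat n). x) = (\<Sum>i<n. complex_of_real (rootn_mat n $$ (i, i)))"
    unfolding eigvals_mset_def
    using sum_proots_char_poly[of "map_mat complex_of_real (rootn_mat n)" n] rootn_mat_carrier
    by simp
  also have "\<dots> = 1" using rootn_mat_trace by (simp flip: of_real_sum)
  finally have sum: "(\<Sum>x\<in>#?N. x) = 0" unfolding split by simp
  have N01: "x = 0 \<or> x = 1" if "x \<in># ?N" for x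
    using rootn_mat_eigvals[of x] that split by simp
  have "1 \<notin># ?N"
  proof
    assume "1 \<in># ?N"
    then obtain N' where N': "?N = add_mset 1 N'" by (metis insert_DiffM)
    have "Re (\<Sum>x\<in>#M. x) \<ge> 0" if "\<And>x. x \<in># M \<Longrightarrow> x = 0 \<or> x = 1" for M :: "complex multiset"
      using that by (induction M) (auto, fastforce)
    from this[of N'] have "Re (\<Sum>x\<in>#?N. x) \<ge> 1" using N01 by (simp add: N')
    then show False using sum by simp
  qed
  then show ?thesis
    using lambda2_maximal(1)[OF ds n] N01 by metis
qed

end

section \<open>Bounds on the ratio\<close>

text \<open>\<open>Min\<close> is meaningful only on a finite nonempty set; a singleton is
  admissible because \<open>1 \<le> n / 2\<close>.\<close>

lemma edge_expansion_family:
  assumes "n \<ge> 2"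
  defines "F \<equiv> {S. S \<subseteq> {..<n} \<and> S \<noteq> {} \<and> real (card S) \<le> real n / 2}"
  shows "finite F" "{0} \<in> F"
proof -
  show "finite F" unfolding F_def by (rule finite_subset[of _ "Pow {..<n}"]) auto
  show "{0} \<in> F" unfolding F_def using assms(1) by auto
qed

lemma edge_expansion_rootn_mat_le:
  assumes n: "n \<ge> 2"
  shows "edge_expansion n (rootn_mat n) \<le> 1 / sqrt (real n)"
proof -
  let ?m = "sqrt (real n)"
  note fam = edge_expansion_family[OF n]
  have m: "?m > 1" using n by simp
  then have "?m + 2 > 0" by linarith
  then have le1: "(?m + 1) / (?m + 2) \<le> 1" by (simp only: divide_le_eq_1_pos)
  have "edge_expansion n (rootn_mat n)
      \<le> (\<Sum>i\<in>{0}. \<Sum>j\<in>{..<n} - {0}. rootn_mat n $$ (i, j)) / real (card {0 :: nat})"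
    unfolding edge_expansion_def
    using fam by (intro Min_le finite_imageI image_eqI[where x = "{0}"]) auto
  also have "\<dots> = (\<Sum>j\<in>{..<n} - {0}. rootn_mat n $$ (0, j))" by simp
  also have "{..<n} - {0} = insert 1 {2..<n}" using n by auto
  \<comment> \<open>Row 0 sends mass out of the singleton only to index 1.\<close>
  also have "(\<Sum>j\<in>insert 1 {2..<n}. rootn_mat n $$ (0, j)) = rootn_mat n $$ (0, 1)"
    using rootn_mat_first_row(3)[OF n] by simp
  also have "\<dots> = (?m + 1)\<^sup>2 / (?m * (?m + 1) * (?m + 2))" by (rule rootn_mat_first_row(2)[OF n])
  also have "\<dots> = (?m + 1) / (?m + 2) / ?m" using m by (simp add: power2_eq_square)
  also have "\<dots> \<le> 1 / ?m" using m le1 by (intro divide_right_mono) auto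
  finally show ?thesis .
qed

lemma edge_expansion_ge:
  assumes ds: "doubly_stochastic n A" and n: "n \<ge> 2"
  shows "1 - Re (lambda2 A) \<le> 35 * real n * edge_expansion n A"
proof -
  let ?F = "{S. S \<subseteq> {..<n} \<and> S \<noteq> {} \<and> real (card S) \<le> real n / 2}"
  let ?g = "\<lambda>S. (\<Sum>i\<in>S. \<Sum>j\<in>{..<n} - S. A $$ (i, j)) / real (card S)"
  note fam = edge_expansion_family[OF n]
  have "edge_expansion n A \<in> ?g ` ?F"
    unfolding edge_expansion_def using fam by (intro Min_in) auto
  then obtain S where "S \<in> ?F" "edge_expansion n A = ?g S" by blast
  then show ?thesis using spectral_gap_le_cut[OF ds n, of S] by auto
qed

theorem theorem4:
  fixes n :: nat
  assumes "n \<ge> 2"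
  shows "1 / (35 * real n) \<le> Gamma_ratio n \<and> Gamma_ratio n \<le> 1 / sqrt (real n)"
proof -
  let ?R = "{edge_expansion n A / (1 - Re (lambda2 A)) | A.
            doubly_stochastic n A \<and> Re (lambda2 A) \<noteq> 1}"
  note n = assms
  have lower: "1 / (35 * real n) \<le> x" if xR: "x \<in> ?R" for x
  proof -
    obtain A where A: "doubly_stochastic n A" "Re (lambda2 A) \<noteq> 1"
      and x: "x = edge_expansion n A / (1 - Re (lambda2 A))"
      using xR by blast
    \<comment> \<open>Leaving out real part 1 makes the denominator positive, so dividing by it
      keeps the inequality.\<close>
    have "1 - Re (lambda2 A) > 0" using abs_Re_lambda2_le_1[OF A(1) n] A(2) by simp
    then show ?thesis
      using edge_expansion_ge[OF A(1) n] n unfolding x by (simp add: field_simps)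
  qed
  \<comment> \<open>Since \<open>lambda2\<close> of this matrix is 0, its quotient is the edge
    expansion itself. Membership also supplies the nonemptiness without which \<open>Inf\<close>
    would not inherit the lower bound.\<close>
  have mem: "edge_expansion n (rootn_mat n) \<in> ?R"
    using rootn_mat_doubly_stochastic[OF n] rootn_mat_lambda2[OF n]
    by (intro CollectI exI[of _ "rootn_mat n"]) auto
  have "1 / (35 * real n) \<le> Inf ?R"
    using mem lower by (intro cInf_greatest) auto
  moreover have "Inf ?R \<le> edge_expansion n (rootn_mat n)"
    using mem lower by (intro cInf_lower bdd_belowI) auto
  ultimately show ?thesis
    using edge_expansion_rootn_mat_le[OF n] unfolding Gamma_ratio_def by linarith
qed

end
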